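(* Suppose that the disjointness property holds: for all $F,G\in\mathrm{et}_p(\mathbb{C}^2)$, if $F\neq G$ then $L_F(\mathrm{et}(\mathbb{C}^2))\cap L_G(\mathrm{et}(\mathbb{C}^2))=\emptyset$. Then the two dimensional Jacobian Conjecture is valid: every $F\in\mathbb{C}[X,Y]^2$ with $\det J_F\equiv 1$ is, as a mapping $\mathbb{C}^2\to\mathbb{C}^2$, injective and surjective with $F^{-1}\in\mathbb{C}[X,Y]^2$.
   Context: $J_F$ denotes the Jacobian matrix of $F$. $\mathrm{et}(\mathbb{C}^2)$ denotes the set of all polynomial mappings $G=(G_1,G_2)\in\mathbb{C}[X,Y]^2$ such that (1) $\det J_G\equiv 1$, and (2) $\deg G_1=\deg_Y G_1$ and $\deg G_2=\deg_Y G_2$. With composition $\circ$ as binary operation, $(\mathrm{et}(\mathbb{C}^2),\circ)$ is taken to be a semigroup with unit $\mathrm{id}$; it contains the group $\mathrm{Aut}(\mathbb{C}^2)$ of all invertible polynomial mappings (subject to conditions (1) and (2)). For $F\in\mathrm{et}(\mathbb{C}^2)$ the left composition mapping is $L_F:\mathrm{et}(\mathbb{C}^2)\to\mathrm{et}(\mathbb{C}^2)$, $L_F(G)=F\circ G$. A mapping $F\in\mathrm{et}(\mathbb{C}^2)$ is composite if there are $G,H\in\mathrm{et}(\mathbb{C}^2)-\mathrm{Aut}(\mathbb{C}^2)$ with $F=G\circ H$; a mapping in $\mathrm{et}(\mathbb{C}^2)-\mathrm{Aut}(\mathbb{C}^2)$ is prime if it is not composite. $\mathrm{et}_p(\mathbb{C}^2)$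 is the set of prime mappings. *)

theory Defs
  imports "HOL-Analysis.Determinants" "HOL-Computational_Algebra.Polynomial"
begin

text \<open>
  The ring of polynomials in \<open>X\<close>, \<open>Y\<close> over the complex numbers is represented as polynomials
  in \<open>Y\<close> (outer variable) with coefficients in the polynomials in \<open>X\<close> (inner variable).
  Hence the degree in \<open>Y\<close> is just \<^const>\<open>degree\<close>, and the coefficient of
  \<open>X^i * Y^j\<close> in \<open>p\<close> is \<open>coeff (coeff p j) i\<close>.
\<close>

type_synonym cpoly2 = "complex poly poly"
type_synonym polymap = "cpoly2 \<times> cpoly2"

definition varX :: cpoly2 where "varX = [:[:0, 1:]:]"
definition varY :: cpoly2 where "varY = [:0, 1:]"

abbreviation degree_Y :: "cpoly2 \<Rightarrow> nat" where "degree_Y p \<equiv> degree p"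

text \<open>As for \<^const>\<open>degree\<close>, the zero polynomial has total degree 0.\<close>

definition total_degree :: "cpoly2 \<Rightarrow> nat" where
  "total_degree p = Max (insert 0 {i + j | i j. coeff (coeff p j) i \<noteq> 0})"

definition deriv_X :: "cpoly2 \<Rightarrow> cpoly2" where "deriv_X p = map_poly pderiv p"
definition deriv_Y :: "cpoly2 \<Rightarrow> cpoly2" where "deriv_Y p = pderiv p"

definition jacobian_matrix :: "polymap \<Rightarrow> cpoly2 ^ 2 ^ 2" where
  "jacobian_matrix F =
     vector [vector [deriv_X (fst F), deriv_Y (fst F)],
             vector [deriv_X (snd F), deriv_Y (snd F)]]"

definition eval2 :: "cpoly2 \<Rightarrow> complex \<Rightarrow> complex \<Rightarrow> complex" where
  "eval2 p x y = poly (poly p [:y:]) x"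

definition polymap_fun :: "polymap \<Rightarrow> complex \<times> complex \<Rightarrow> complex \<times> complex" where
  "polymap_fun F = (\<lambda>(x, y). (eval2 (fst F) x y, eval2 (snd F) x y))"

text \<open>
  Substitution of \<open>A\<close> for \<open>X\<close> and \<open>B\<close> for \<open>Y\<close>: each coefficient \<open>c\<close>, a polynomial
  in \<open>X\<close>, is replaced by \<open>c(A)\<close>, and the resulting polynomial is evaluated at \<open>B\<close>.
\<close>

definition subst2 :: "cpoly2 \<Rightarrow> cpoly2 \<Rightarrow> cpoly2 \<Rightarrow> cpoly2" where
  "subst2 p A B = poly (map_poly (\<lambda>c. poly (map_poly (\<lambda>a. [:[:a:]:]) c) A) p) B"

definition polymap_comp :: "polymap \<Rightarrow> polymap \<Rightarrow> polymap" (infixl \<open>\<circ>\<^sub>P\<close> 55) where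
  "F \<circ>\<^sub>P G = (subst2 (fst F) (fst G) (snd G), subst2 (snd F) (fst G) (snd G))"

definition polymap_id :: polymap where "polymap_id = (varX, varY)"

definition invertible_polymap :: "polymap \<Rightarrow> bool" where
  "invertible_polymap F \<longleftrightarrow> (\<exists>G. F \<circ>\<^sub>P G = polymap_id \<and> G \<circ>\<^sub>P F = polymap_id)"

text \<open>
  \<open>et_maps\<close> is exactly the set cut out by the Jacobian and the degree condition.  The
  identity violates the degree condition (\<open>varX\<close> has degree 1 but degree 0 in \<open>Y\<close>), and
  the set is not closed under composition; neither property is imposed.  Since the identity is
  invertible, adjoining it would not change \<open>et_prime\<close>; it would only enlarge the images under
  left composition.  In \<open>et_Aut\<close> the degree condition is required of the mapping itself, not
  of its inverse.
\<close>

definition et_maps :: "polymap set" where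
  "et_maps = {G. det (jacobian_matrix G) = 1 \<and>
                 total_degree (fst G) = degree_Y (fst G) \<and>
                 total_degree (snd G) = degree_Y (snd G)}"

definition et_Aut :: "polymap set" where
  "et_Aut = {F \<in> et_maps. invertible_polymap F}"

definition left_comp :: "polymap \<Rightarrow> polymap \<Rightarrow> polymap" where
  "left_comp F G = F \<circ>\<^sub>P G"

definition et_composite :: "polymap \<Rightarrow> bool" where
  "et_composite F \<longleftrightarrow> (\<exists>G \<in> et_maps - et_Aut. \<exists>H \<in> et_maps - et_Aut. F = G \<circ>\<^sub>P H)"

definition et_prime :: "polymap set" where
  "et_prime = {F \<in> et_maps - et_Aut. \<not> et_composite F}"

lemma eval2_add: "eval2 (p + q) x y = eval2 p x y + eval2 q x y"
  by (simp add: eval2_def)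

lemma eval2_mult: "eval2 (p * q) x y = eval2 p x y * eval2 q x y"
  by (simp add: eval2_def)

lemma eval2_subst_inner:
  "eval2 (poly (map_poly (\<lambda>a. [:[:a:]:]) c) A) x y = poly c (eval2 A x y)"
proof (induction c)
  case 0
  show ?case by (simp add: eval2_def)
next
  case (pCons a c)
  have "map_poly (\<lambda>a. [:[:a:]:]) (pCons a c) =
      pCons [:[:a:]:] (map_poly (\<lambda>a. [:[:a::complex:]:]) c)"
    using pCons.hyps by (intro map_poly_pCons) auto
  with pCons.IH show ?case
    by (simp add: eval2_add eval2_mult) (simp add: eval2_def)
qed

lemma eval2_subst2: "eval2 (subst2 p A B) x y = eval2 p (eval2 A x y) (eval2 B x y)"
proof (induction p)
  case 0
  show ?case by (simp add: subst2_def eval2_def)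
next
  case (pCons c p)
  have "subst2 (pCons c p) A B =
      poly (map_poly (\<lambda>a. [:[:a:]:]) c) A + B * subst2 p A B"
    using pCons.hyps by (simp add: subst2_def map_poly_pCons)
  with pCons.IH show ?case
    by (simp add: eval2_add eval2_mult eval2_subst_inner) (simp add: eval2_def)
qed

lemma polymap_fun_comp: "polymap_fun (F \<circ>\<^sub>P G) = polymap_fun F \<circ> polymap_fun G"
  by (auto simp: polymap_fun_def polymap_comp_def eval2_subst2 fun_eq_iff)

lemma polymap_fun_id: "polymap_fun polymap_id = id"
  by (auto simp: polymap_fun_def polymap_id_def varX_def varY_def eval2_def fun_eq_iff)

lemma finite_support2: "finite {i + j | i j. coeff (coeff (p :: cpoly2) j) i \<noteq> 0}"
proof -
  let ?S = "SIGMA j:{..degree p}. {..degree (coeff p j)}"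
  have "{i + j | i j. coeff (coeff p j) i \<noteq> 0} \<subseteq> (\<lambda>(j, i). i + j) ` ?S"
  proof
    fix n assume "n \<in> {i + j | i j. coeff (coeff p j) i \<noteq> 0}"
    then obtain i j where n: "n = i + j" and c: "coeff (coeff p j) i \<noteq> 0" by blast
    from c have "coeff p j \<noteq> 0" by auto
    then have "(j, i) \<in> ?S" using c by (auto intro: le_degree)
    then show "n \<in> (\<lambda>(j, i). i + j) ` ?S" using n by force
  qed
  then show ?thesis by (rule finite_subset) auto
qed

end

theory Submission
  imports
    Defs
    "HOL-Computational_Algebra.Polynomial_Factorial"
    "HOL-Computational_Algebra.Field_as_Ring"
    "HOL-Computational_Algebra.Fundamental_Theorem_Algebra"
begin

text \<open>
  Call \<open>F\<close> a Keller map if \<open>det J\<^sub>F = 1\<close>.  The disjointness hypothesis can hold only if there are no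
  prime mappings at all.  If \<open>P\<close> is prime and \<open>N\<close> is the point reflection \<open>(X, Y) \<mapsto> (- X, - Y)\<close>,
  then \<open>P \<circ> N\<close> is prime as well, it differs from \<open>P\<close> since the derivative of \<open>P\<close> at the origin is
  not zero, and \<open>(P \<circ> N) \<circ> P = P \<circ> (N \<circ> P)\<close> lies in both images.  So it has to be shown that a
  Keller map without polynomial inverse gives rise to a prime mapping.

  A generic shear \<open>(X + t Y, Y)\<close> composed on the right brings a Keller map into \<^const>\<open>et_maps\<close>
  (\<open>keller_comp_shear_et\<close>).  Among the non-automorphisms in \<^const>\<open>et_maps\<close> take
  one, \<open>F\<close>, for which the field degree \<open>[\<complex>(X, Y) : \<complex>(F\<^sub>1, F\<^sub>2)]\<close> is least.  If \<open>F = G \<circ> H\<close> with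
  non-automorphisms \<open>G\<close> and \<open>H\<close>, then \<open>\<complex>(F\<^sub>1, F\<^sub>2)\<close> is a proper subfield of \<open>\<complex>(H\<^sub>1, H\<^sub>2)\<close>, so that
  \<open>H\<close> has smaller field degree, a contradiction.  Properness is the classical theorem of
  Keller that a birational Keller map is an automorphism (\<open>birational_keller_invertible\<close>): a
  prime factor in the denominator of \<open>X\<close> or \<open>Y\<close>, written as a fraction in \<open>F\<^sub>1, F\<^sub>2\<close>, would yield
  a curve contracted to a point, which the nonvanishing Jacobian determinant rules out.

  Fraction fields are avoided by clearing denominators.  The field degree becomes the maximal size
  of a family of polynomials that is linearly independent over the ring \<open>\<complex>[F\<^sub>1, F\<^sub>2]\<close>; it is finite
  by a dimension count (\<open>pullback_indep_bound\<close>), and its strict decrease is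
  \<open>extension_degree_less_comp\<close>.
\<close>

section \<open>Polynomials in two variables and substitution homomorphisms\<close>

text \<open>
  A nonzero polynomial in \<open>Y\<close> over the domain \<open>\<complex>[X]\<close> has finitely many roots, and the constants
  already supply infinitely many candidates.  All ring identities between substitutions are
  obtained from this principle, by evaluating both sides at a point.
\<close>

lemma poly2_eqI:
  assumes "\<And>x y. eval2 p x y = eval2 q x y"
  shows "p = q"
proof (rule ccontr)
  assume "p \<noteq> q"
  then have "p - q \<noteq> 0" by simp
  then have "finite {c. poly (p - q) c = 0}" by (rule poly_roots_finite)
  moreover have "poly (p - q) [:y:] = 0" for y
  proof -
    have "poly (poly p [:y:]) = poly (poly q [:y:])"
      using assms by (auto simp: eval2_def)
    then show ?thesis by (simp add: poly_eq_poly_eq_iff)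
  qed
  then have "range (\<lambda>y::complex. [:y:]) \<subseteq> {c. poly (p - q) c = 0}" by auto
  ultimately have "finite (range (\<lambda>y::complex. [:y:]))" by (rule finite_subset[rotated])
  then have "finite (UNIV :: complex set)" by (rule finite_imageD) (auto simp: inj_def)
  then show False by (simp add: infinite_UNIV_char_0)
qed

lemma eval2_const [simp]: "eval2 [:[:a:]:] x y = a"
  and eval2_0 [simp]: "eval2 0 x y = 0"
  and eval2_1 [simp]: "eval2 1 x y = 1"
  and eval2_varX [simp]: "eval2 varX x y = x"
  and eval2_varY [simp]: "eval2 varY x y = y"
  and eval2_inner [simp]: "eval2 [:c:] x y = poly c x"
  and eval2_smult [simp]: "eval2 (smult c p) x y = poly c x * eval2 p x y"
  and eval2_uminus [simp]: "eval2 (- p) x y = - eval2 p x y"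
  and eval2_diff [simp]: "eval2 (p - q) x y = eval2 p x y - eval2 q x y"
  and eval2_power [simp]: "eval2 (p ^ n) x y = eval2 p x y ^ n"
  by (simp_all add: eval2_def varX_def varY_def)

lemma eval2_sum [simp]: "eval2 (sum f A) x y = (\<Sum>a\<in>A. eval2 (f a) x y)"
  by (induction A rule: infinite_finite_induct) (simp_all add: eval2_add)

lemmas [simp] = eval2_add eval2_mult eval2_subst2

lemma eval2_monom [simp]: "eval2 (monom (monom a i) j) x y = a * x ^ i * y ^ j"
  by (simp add: eval2_def poly_monom)

text \<open>
  Composition with \<open>F\<close>, regarded as an endomorphism of the ring \<open>\<complex>[X, Y]\<close>.  Its image is the
  subring \<open>\<complex>[F\<^sub>1, F\<^sub>2]\<close>, and it reverses the order of composition.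
\<close>

definition pullback :: "polymap \<Rightarrow> cpoly2 \<Rightarrow> cpoly2" where
  "pullback F p = subst2 p (fst F) (snd F)"

lemma eval2_pullback [simp]:
  "eval2 (pullback F p) x y = eval2 p (eval2 (fst F) x y) (eval2 (snd F) x y)"
  by (simp add: pullback_def)

lemma pullback_0 [simp]: "pullback F 0 = 0"
  and pullback_1 [simp]: "pullback F 1 = 1"
  and pullback_const [simp]: "pullback F [:[:a:]:] = [:[:a:]:]"
  and pullback_add: "pullback F (p + q) = pullback F p + pullback F q"
  and pullback_uminus: "pullback F (- p) = - pullback F p"
  and pullback_diff: "pullback F (p - q) = pullback F p - pullback F q"
  and pullback_mult: "pullback F (p * q) = pullback F p * pullback F q"
  and pullback_sum: "pullback F (sum f A) = (\<Sum>a\<in>A. pullback F (f a))"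
  and pullback_varX [simp]: "pullback F varX = fst F"
  and pullback_varY [simp]: "pullback F varY = snd F"
  by (rule poly2_eqI; simp del: eval2_inner)+

lemma pullback_comp: "pullback (F \<circ>\<^sub>P G) p = pullback G (pullback F p)"
  by (rule poly2_eqI) (simp add: polymap_comp_def)

lemma polymap_comp_pullback: "F \<circ>\<^sub>P G = (pullback G (fst F), pullback G (snd F))"
  by (simp add: polymap_comp_def pullback_def)

lemma polymap_comp_assoc: "(F \<circ>\<^sub>P G) \<circ>\<^sub>P H = F \<circ>\<^sub>P (G \<circ>\<^sub>P H)"
  by (auto simp: polymap_comp_def prod_eq_iff intro!: poly2_eqI)

lemma polymap_comp_id [simp]: "F \<circ>\<^sub>P polymap_id = F" "polymap_id \<circ>\<^sub>P F = F"
  by (auto simp: polymap_comp_def polymap_id_def prod_eq_iff intro!: poly2_eqI)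

lemma invertible_polymap_comp:
  assumes "invertible_polymap F" "invertible_polymap G"
  shows "invertible_polymap (F \<circ>\<^sub>P G)"
proof -
  obtain F' G' where *: "F \<circ>\<^sub>P F' = polymap_id" "F' \<circ>\<^sub>P F = polymap_id"
      "G \<circ>\<^sub>P G' = polymap_id" "G' \<circ>\<^sub>P G = polymap_id"
    using assms by (auto simp: invertible_polymap_def)
  have "(F \<circ>\<^sub>P G) \<circ>\<^sub>P (G' \<circ>\<^sub>P F') = F \<circ>\<^sub>P ((G \<circ>\<^sub>P G') \<circ>\<^sub>P F')"
    "(G' \<circ>\<^sub>P F') \<circ>\<^sub>P (F \<circ>\<^sub>P G) = G' \<circ>\<^sub>P ((F' \<circ>\<^sub>P F) \<circ>\<^sub>P G)"
    by (simp_all only: polymap_comp_assoc)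
  with * show ?thesis unfolding invertible_polymap_def
    by (intro exI [of _ "G' \<circ>\<^sub>P F'"]) simp
qed

lemma invertible_polymap_comp_right_iff:
  assumes "invertible_polymap G"
  shows "invertible_polymap (F \<circ>\<^sub>P G) \<longleftrightarrow> invertible_polymap F"
proof
  assume FG: "invertible_polymap (F \<circ>\<^sub>P G)"
  obtain G' where G': "G \<circ>\<^sub>P G' = polymap_id" "G' \<circ>\<^sub>P G = polymap_id"
    using assms by (auto simp: invertible_polymap_def)
  then have "invertible_polymap G'" unfolding invertible_polymap_def by blast
  with FG have "invertible_polymap ((F \<circ>\<^sub>P G) \<circ>\<^sub>P G')" by (rule invertible_polymap_comp)
  then show "invertible_polymap F" using G' by (simp add: polymap_comp_assoc)
qed (use assms in \<open>simp add: invertible_polymap_comp\<close>)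

section \<open>Derivations and the injectivity of Keller pullbacks\<close>

lemma deriv_X_add: "deriv_X (p + q) = deriv_X p + deriv_X q"
  and deriv_Y_add: "deriv_Y (p + q) = deriv_Y p + deriv_Y q"
  by (simp_all add: deriv_X_def deriv_Y_def poly_eq_iff coeff_map_poly pderiv_add)

lemma coeff_deriv_X: "coeff (deriv_X p) n = pderiv (coeff p n)"
  by (simp add: deriv_X_def coeff_map_poly)

lemma deriv_X_pCons: "deriv_X (pCons c p) = pCons (pderiv c) (deriv_X p)"
  by (rule poly_eqI) (simp add: coeff_deriv_X coeff_pCons split: nat.split)

lemma deriv_X_0 [simp]: "deriv_X 0 = 0" and deriv_Y_0 [simp]: "deriv_Y 0 = 0"
  by (simp_all add: deriv_X_def deriv_Y_def)

lemma deriv_Y_pCons: "deriv_Y (pCons c p) = p + pCons 0 (deriv_Y p)"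
  by (simp add: deriv_Y_def pderiv_pCons)

lemma deriv_Y_mult: "deriv_Y (p * q) = p * deriv_Y q + deriv_Y p * q"
  by (simp add: deriv_Y_def pderiv_mult)

lemma deriv_X_mult: "deriv_X (p * q) = p * deriv_X q + deriv_X p * q"
proof (induction p)
  case (pCons c p)
  have "deriv_X (smult c q) = smult c (deriv_X q) + smult (pderiv c) q"
    by (rule poly_eqI) (simp add: coeff_deriv_X pderiv_mult)
  with pCons.IH show ?case by (simp add: deriv_X_add deriv_X_pCons algebra_simps)
qed (simp add: deriv_X_def)

text \<open>
  The two partial derivatives obey the same chain rule, and its proof uses only that they are
  \<open>\<complex>\<close>-linear derivations.
\<close>

locale derivation2 =
  fixes D :: "cpoly2 \<Rightarrow> cpoly2"
  assumes add: "D (p + q) = D p + D q"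
    and mult: "D (p * q) = p * D q + D p * q"
    and const [simp]: "D [:[:a:]:] = 0"
begin

lemma zero [simp]: "D 0 = 0"
  using const[of 0] by simp

lemma chain_rule_inner:
  "D (pullback F [:c:]) = pullback F [:pderiv c:] * D (fst F)"
proof (induction c)
  case (pCons a c)
  have 1: "pullback F [:pCons a c:] = [:[:a:]:] + fst F * pullback F [:c:]"
    and 2: "pullback F [:pderiv (pCons a c):]
      = pullback F [:c:] + fst F * pullback F [:pderiv c:]"
    by (rule poly2_eqI; simp add: pderiv_pCons)+
  show ?case unfolding 1 2 by (simp add: add mult pCons.IH algebra_simps)
qed simp

lemma chain_rule:
  "D (pullback F p) = pullback F (deriv_X p) * D (fst F) + pullback F (deriv_Y p) * D (snd F)"
proof (induction p)
  case (pCons c p)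
  have split: "pCons c p = [:c:] + varY * p" for c :: "complex poly" and p
    by (simp add: varY_def)
  have 1: "pullback F (pCons c p) = pullback F [:c:] + snd F * pullback F p" 
    by (subst split) (simp add: pullback_add pullback_mult)
  have 2: "pullback F (deriv_X (pCons c p))
      = pullback F [:pderiv c:] + snd F * pullback F (deriv_X p)"
    unfolding deriv_X_pCons by (subst split) (simp add: pullback_add pullback_mult)
  have 3: "pullback F (deriv_Y (pCons c p)) = pullback F p + snd F * pullback F (deriv_Y p)"
    unfolding deriv_Y_pCons by (subst split) (simp add: pullback_add pullback_mult)
  show ?case unfolding 1 2 3
    by (simp add: add mult pCons.IH chain_rule_inner algebra_simps)
qed simp

end

interpretation DX: derivation2 deriv_X
  by standard (simp_all add: deriv_X_add deriv_X_mult deriv_X_pCons pderiv_pCons)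
interpretation DY: derivation2 deriv_Y
  by standard (simp_all add: deriv_Y_add deriv_Y_mult deriv_Y_pCons pderiv_pCons)

lemma det_jacobian:
  "det (jacobian_matrix F) = deriv_X (fst F) * deriv_Y (snd F) - deriv_Y (fst F) * deriv_X (snd F)"
  by (simp add: det_2 jacobian_matrix_def)

lemma det_jacobian_comp:
  "det (jacobian_matrix (F \<circ>\<^sub>P G)) = pullback G (det (jacobian_matrix F)) * det (jacobian_matrix G)"
  by (simp add: det_jacobian polymap_comp_pullback DX.chain_rule DY.chain_rule pullback_diff
      pullback_mult algebra_simps)

lemma deriv_Y_eq_0D: "deriv_Y p = 0 \<Longrightarrow> \<exists>c. p = [:c:]"
  unfolding deriv_Y_def by (metis pderiv_eq_0_iff degree_eq_zeroE)

text \<open>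
  By the chain rule, differentiating \<open>p(F) = 0\<close> shows that the row vector
  \<open>(p\<^sub>X(F), p\<^sub>Y(F))\<close> annihilates the Jacobian matrix, which is invertible.
\<close>

lemma keller_gradient:
  assumes "det (jacobian_matrix F) = 1" and "pullback F p = 0"
  shows "pullback F (deriv_X p) = 0" "pullback F (deriv_Y p) = 0"
proof -
  let ?a = "pullback F (deriv_X p)" and ?b = "pullback F (deriv_Y p)"
  have det: "deriv_X (fst F) * deriv_Y (snd F) - deriv_Y (fst F) * deriv_X (snd F) = 1"
    using assms(1) by (simp only: det_jacobian)
  have x: "?a * deriv_X (fst F) + ?b * deriv_X (snd F) = 0"
    and y: "?a * deriv_Y (fst F) + ?b * deriv_Y (snd F) = 0"
    using DX.chain_rule[of F p] DY.chain_rule[of F p] assms(2) by simp_all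
  show "?a = 0" using det x y by algebra
  show "?b = 0" using det x y by algebra
qed

text \<open>
  The components of a Keller map are algebraically independent: with a relation \<open>p\<close> its partial
  derivatives are relations too, by \<open>keller_gradient\<close>, and repeated differentiation ends in a
  nonzero constant.
\<close>

lemma keller_pullback_eq_0:
  assumes "det (jacobian_matrix F) = 1" "pullback F p = 0"
  shows "p = 0"
  using assms(2)
proof (induction "degree p" arbitrary: p rule: less_induct)
  case less
  have "deriv_Y p = 0"
  proof (cases "degree p = 0")
    case False
    then have "degree (deriv_Y p) < degree p" by (simp add: deriv_Y_def degree_pderiv)
    then show ?thesis using less keller_gradient[OF assms(1)] by blast
  qed (simp add: deriv_Y_def pderiv_eq_0_iff)
  then obtain c where c: "p = [:c:]" using deriv_Y_eq_0D by blast
  have "[:c:] = 0" if "pullback F [:c:] = 0" for c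
    using that
  proof (induction "degree c" arbitrary: c rule: less_induct)
    case less
    have "pderiv c = 0"
    proof (cases "degree c = 0")
      case False
      then have "degree (pderiv c) < degree c" by (simp add: degree_pderiv)
      moreover have "pullback F [:pderiv c:] = 0"
        using keller_gradient(1)[OF assms(1) less.prems] by (simp add: deriv_X_pCons)
      ultimately show ?thesis using less by fastforce
    qed (simp add: pderiv_eq_0_iff)
    then obtain a where "c = [:a:]" by (metis pderiv_eq_0_iff degree_eq_zeroE)
    then show ?case using less.prems by simp
  qed
  then show ?case using less.prems c by blast
qed

lemma keller_inj:
  assumes "det (jacobian_matrix F) = 1"
  shows "pullback F p = pullback F q \<longleftrightarrow> p = q"
  using keller_pullback_eq_0[OF assms, of "p - q"] by (auto simp: pullback_diff)

section \<open>Total degree and the pure power of Y\<close>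

definition tdeg_le :: "nat \<Rightarrow> cpoly2 \<Rightarrow> bool" where
  "tdeg_le n p \<longleftrightarrow> (\<forall>i j. coeff (coeff p j) i \<noteq> 0 \<longrightarrow> i + j \<le> n)"

lemma tdeg_leD: "tdeg_le n p \<Longrightarrow> coeff (coeff p j) i \<noteq> 0 \<Longrightarrow> i + j \<le> n"
  by (auto simp: tdeg_le_def)

lemma tdeg_le_mono: "tdeg_le m p \<Longrightarrow> m \<le> n \<Longrightarrow> tdeg_le n p"
  unfolding tdeg_le_def by (meson le_trans)

lemma tdeg_le_total_degree: "tdeg_le (total_degree p) p"
  unfolding tdeg_le_def total_degree_def
  by (intro allI impI Max_ge) (use finite_support2[of p] in auto)

lemma total_degree_le: "tdeg_le n p \<Longrightarrow> total_degree p \<le> n"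
  using finite_support2[of p] by (auto simp: total_degree_def tdeg_le_def)

lemma total_degree_attained:
  assumes "p \<noteq> 0"
  obtains i j where "coeff (coeff p j) i \<noteq> 0" "i + j = total_degree p"
proof -
  let ?S = "{i + j | i j. coeff (coeff p j) i \<noteq> 0}"
  obtain i j where ij: "coeff (coeff p j) i \<noteq> 0"
    using assms by (metis leading_coeff_0_iff)
  have "total_degree p \<in> insert 0 ?S"
    unfolding total_degree_def by (rule Max_in) (use finite_support2[of p] in auto)
  then show ?thesis
  proof
    assume "total_degree p = 0"
    with ij tdeg_leD[OF tdeg_le_total_degree ij] show ?thesis by (intro that[OF ij]) auto
  qed (use that in auto)
qed

lemma tdeg_le_degree: "tdeg_le n p \<Longrightarrow> degree p \<le> n"
  by (metis tdeg_leD leading_coeff_0_iff degree_0 add_leD2 le0)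

lemma tdeg_le_add: "tdeg_le n p \<Longrightarrow> tdeg_le n q \<Longrightarrow> tdeg_le n (p + q)"
  unfolding tdeg_le_def by (metis add.left_neutral coeff_add)

lemma tdeg_le_0 [simp]: "tdeg_le n 0"
  by (simp add: tdeg_le_def)

lemma tdeg_le_sum: "(\<And>a. a \<in> A \<Longrightarrow> tdeg_le n (f a)) \<Longrightarrow> tdeg_le n (sum f A)"
  by (induction A rule: infinite_finite_induct) (auto intro: tdeg_le_add)

lemma tdeg_le_const: "tdeg_le 0 [:[:a:]:]"
  by (auto simp: tdeg_le_def coeff_pCons split: nat.splits)

lemma tdeg_le_varX: "tdeg_le 1 varX" and tdeg_le_varY: "tdeg_le 1 varY"
  by (auto simp: tdeg_le_def varX_def varY_def coeff_pCons split: nat.splits)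

lemma tdeg_le_uminus: "tdeg_le n p \<Longrightarrow> tdeg_le n (- p)"
  by (simp add: tdeg_le_def)

lemma tdeg_le_mult:
  assumes "tdeg_le m p" "tdeg_le n q"
  shows "tdeg_le (m + n) (p * q)"
  unfolding tdeg_le_def
proof (intro allI impI)
  fix i j assume "coeff (coeff (p * q) j) i \<noteq> 0"
  then have "(\<Sum>k\<le>j. \<Sum>l\<le>i. coeff (coeff p k) l * coeff (coeff q (j - k)) (i - l)) \<noteq> 0"
    by (simp add: coeff_mult coeff_sum)
  then obtain k where k: "k \<le> j"
      "(\<Sum>l\<le>i. coeff (coeff p k) l * coeff (coeff q (j - k)) (i - l)) \<noteq> 0"
    by (metis (no_types, lifting) sum.not_neutral_contains_not_neutral atMost_iff)
  then obtain l where l: "l \<le> i" "coeff (coeff p k) l * coeff (coeff q (j - k)) (i - l) \<noteq> 0"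
    by (metis (no_types, lifting) sum.not_neutral_contains_not_neutral atMost_iff)
  from l have "l + k \<le> m" "(i - l) + (j - k) \<le> n"
    using assms by (auto dest: tdeg_leD)
  with k l show "i + j \<le> m + n" by linarith
qed

lemma tdeg_le_1: "tdeg_le 0 1"
  using tdeg_le_const[of 1] by (simp add: one_pCons)

lemma tdeg_le_power: "tdeg_le m p \<Longrightarrow> tdeg_le (k * m) (p ^ k)"
  by (induction k) (auto simp: tdeg_le_1 intro: tdeg_le_mult)

text \<open>
  If \<open>n\<close> bounds the total degree, this is the only coefficient of total degree \<open>n\<close> that belongs to a
  power of \<open>Y\<close> alone; with respect to such bounds it is multiplicative.
\<close>

definition ytop :: "nat \<Rightarrow> cpoly2 \<Rightarrow> complex" where
  "ytop n p = coeff (coeff p n) 0"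

lemma ytop_mult:
  assumes "tdeg_le m p" "tdeg_le n q"
  shows "ytop (m + n) (p * q) = ytop m p * ytop n q"
proof -
  have "ytop (m + n) (p * q)
      = (\<Sum>k\<le>m + n. coeff (coeff p k) 0 * coeff (coeff q (m + n - k)) 0)"
    by (simp add: ytop_def coeff_mult coeff_sum)
  also have "\<dots> = (\<Sum>k\<in>{m}. coeff (coeff p k) 0 * coeff (coeff q (m + n - k)) 0)"
  proof (rule sum.mono_neutral_right)
    show "\<forall>k\<in>{..m + n} - {m}. coeff (coeff p k) 0 * coeff (coeff q (m + n - k)) 0 = 0"
    proof
      fix k assume k: "k \<in> {..m + n} - {m}"
      show "coeff (coeff p k) 0 * coeff (coeff q (m + n - k)) 0 = 0"
      proof (rule ccontr)
        assume "\<not> ?thesis"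
        then have "0 + k \<le> m" "0 + (m + n - k) \<le> n"
          using assms by (auto dest: tdeg_leD)
        with k show False by auto
      qed
    qed
  qed auto
  finally show ?thesis by (simp add: ytop_def)
qed

lemma ytop_power:
  assumes "tdeg_le m p"
  shows "ytop (k * m) (p ^ k) = ytop m p ^ k"
proof (induction k)
  case (Suc k)
  then show ?case
    using ytop_mult[OF assms tdeg_le_power[OF assms, of k]] by simp
qed (simp add: ytop_def)

lemma ytop_sum: "ytop n (sum f A) = (\<Sum>a\<in>A. ytop n (f a))"
  by (simp add: ytop_def coeff_sum)

lemma ytop_eq_0: "tdeg_le m p \<Longrightarrow> m < n \<Longrightarrow> ytop n p = 0"
  unfolding ytop_def using tdeg_leD[of m p n 0] by fastforce

text \<open>
  The degree condition defining \<^const>\<open>et_maps\<close> says that some monomial \<open>X^i * Y^n\<close> occurs with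
  \<open>n\<close> equal to the total degree, which forces \<open>i = 0\<close>.  In this form the condition can be followed
  through substitutions.
\<close>

lemma total_degree_eq_degree_iff:
  assumes "p \<noteq> 0"
  shows "total_degree p = degree p \<longleftrightarrow> (\<exists>n. tdeg_le n p \<and> ytop n p \<noteq> 0)"
proof
  assume eq: "total_degree p = degree p"
  have "lead_coeff p \<noteq> 0" using assms by simp
  then obtain i where i: "coeff (lead_coeff p) i \<noteq> 0" by (metis leading_coeff_0_iff)
  have t: "tdeg_le (degree p) p" using tdeg_le_total_degree[of p] eq by simp
  from tdeg_leD[OF t i] have "i = 0" by simp
  with i t show "\<exists>n. tdeg_le n p \<and> ytop n p \<noteq> 0" unfolding ytop_def by blast
next
  assume "\<exists>n. tdeg_le n p \<and> ytop n p \<noteq> 0"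
  then obtain n where n: "tdeg_le n p" "ytop n p \<noteq> 0" by blast
  then have "n \<le> degree p" by (auto simp: ytop_def intro: le_degree)
  moreover have "total_degree p \<le> n" using n by (rule_tac total_degree_le)
  moreover have "degree p \<le> total_degree p" by (rule tdeg_le_degree[OF tdeg_le_total_degree])
  ultimately show "total_degree p = degree p" by simp
qed

lemma pullback_monom: "pullback F (monom (monom a i) j) = [:[:a:]:] * (fst F ^ i * snd F ^ j)"
  by (rule poly2_eqI) simp

lemma coeff_sum_monom:
  "coeff (coeff (\<Sum>j\<le>n. \<Sum>i\<le>n. monom (monom (f j i :: complex) i) j) l) k
    = (if k \<le> n \<and> l \<le> n then f l k else 0)"
proof -
  have "coeff (coeff (monom (monom a i) j) l) k = (if j = l then if i = k then a else 0 else 0)"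
    for a :: complex and i j
    by simp
  moreover have "(\<Sum>i\<le>n. if j = l then g i else 0) = (if j = l then \<Sum>i\<le>n. g i else 0)"
    for j and g :: "nat \<Rightarrow> complex"
    by simp
  ultimately show ?thesis
    by (simp add: coeff_sum del: coeff_monom)
qed

lemma tdeg_le_expansion:
  assumes "tdeg_le n p"
  shows "p = (\<Sum>j\<le>n. \<Sum>i\<le>n. monom (monom (coeff (coeff p j) i) i) j)"
proof (rule poly_eqI, rule poly_eqI)
  fix l k
  show "coeff (coeff p l) k
      = coeff (coeff (\<Sum>j\<le>n. \<Sum>i\<le>n. monom (monom (coeff (coeff p j) i) i) j) l) k"
    unfolding coeff_sum_monom using tdeg_leD[OF assms, of l k]
    by (cases "coeff (coeff p l) k = 0") auto
qed

lemma pullback_expansion: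
  assumes "tdeg_le n p"
  shows "pullback F p
    = (\<Sum>j\<le>n. \<Sum>i\<le>n. [:[:coeff (coeff p j) i:]:] * (fst F ^ i * snd F ^ j))"
  by (subst tdeg_le_expansion[OF assms]) (simp only: pullback_sum pullback_monom)

text \<open>
  Only the monomials \<open>X^i * Y^(n - i)\<close> of \<open>p\<close> can contribute to \<open>Y^n\<close> after an affine substitution, and
  each contributes through the \<open>Y\<close>-coefficients of the substituted polynomials.
\<close>

lemma pullback_affine:
  assumes p: "tdeg_le n p" and A: "tdeg_le 1 (fst F)" "tdeg_le 1 (snd F)"
  shows tdeg_le_pullback_affine: "tdeg_le n (pullback F p)"
    and ytop_pullback_affine: "ytop n (pullback F p)
      = (\<Sum>i\<le>n. coeff (coeff p (n - i)) i * ytop 1 (fst F) ^ i * ytop 1 (snd F) ^ (n - i))"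
proof -
  let ?c = "\<lambda>j i. coeff (coeff p j) i"
  let ?m = "\<lambda>j i. [:[:?c j i:]:] * (fst F ^ i * snd F ^ j)"
  have td: "tdeg_le (i + j) (fst F ^ i * snd F ^ j)" for i j
    using tdeg_le_mult[OF tdeg_le_power[OF A(1), of i] tdeg_le_power[OF A(2), of j]] by simp
  have td': "tdeg_le (i + j) (?m j i)" for i j
    using tdeg_le_mult[OF tdeg_le_const td] by fastforce
  have "tdeg_le n (?m j i)" for i j
  proof (cases "?c j i = 0")
    case False
    from tdeg_leD[OF p False] td' show ?thesis by (rule tdeg_le_mono[rotated])
  qed simp
  then show "tdeg_le n (pullback F p)"
    unfolding pullback_expansion[OF p] by (intro tdeg_le_sum)
  have yt: "ytop (i + j) (?m j i) = ?c j i * ytop 1 (fst F) ^ i * ytop 1 (snd F) ^ j" for i j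
  proof -
    have "ytop (0 + (i + j)) (?m j i) = ytop 0 [:[:?c j i:]:] * ytop (i + j) (fst F ^ i * snd F ^ j)"
      by (rule ytop_mult[OF tdeg_le_const td])
    also have "ytop (i + j) (fst F ^ i * snd F ^ j) = ytop 1 (fst F) ^ i * ytop 1 (snd F) ^ j"
      using ytop_mult[OF tdeg_le_power[OF A(1), of i] tdeg_le_power[OF A(2), of j]]
        ytop_power[OF A(1), of i] ytop_power[OF A(2), of j] by simp
    finally show ?thesis by (simp add: ytop_def)
  qed
  have "ytop n (?m j i)
      = (if j = n - i then ?c (n - i) i * ytop 1 (fst F) ^ i * ytop 1 (snd F) ^ (n - i) else 0)"
    if "i \<le> n" for i j
  proof (cases "?c j i = 0")
    case False
    consider "i + j = n" | "i + j < n" using tdeg_leD[OF p False] by linarith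
    then show ?thesis
    proof cases
      case 1
      then show ?thesis using yt[of i j] by auto
    next
      case 2
      then show ?thesis using ytop_eq_0[OF td'] by simp
    qed
  qed (auto simp: ytop_def)
  then have "(\<Sum>i\<le>n. \<Sum>j\<le>n. ytop n (?m j i)) = (\<Sum>i\<le>n. \<Sum>j\<le>n.
      if j = n - i then ?c (n - i) i * ytop 1 (fst F) ^ i * ytop 1 (snd F) ^ (n - i) else 0)"
    by (intro sum.cong) auto
  also have "\<dots> = (\<Sum>i\<le>n. ?c (n - i) i * ytop 1 (fst F) ^ i * ytop 1 (snd F) ^ (n - i))"
    by (simp add: sum.delta)
  finally show "ytop n (pullback F p)
      = (\<Sum>i\<le>n. ?c (n - i) i * ytop 1 (fst F) ^ i * ytop 1 (snd F) ^ (n - i))"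
    unfolding pullback_expansion[OF p] ytop_sum by (subst sum.swap)
qed

section \<open>Shears and the point reflection\<close>

text \<open>
  The two automorphisms that are composed with Keller maps: shears establish the degree condition,
  and the point reflection preserves it on either side, so that it produces a second prime mapping
  from a first one.
\<close>

definition neg_map :: polymap where "neg_map = (- varX, - varY)"
definition shear :: "complex \<Rightarrow> polymap" where "shear t = (varX + [:[:t:]:] * varY, varY)"

lemma keller_neg_map: "det (jacobian_matrix neg_map) = 1"
  and keller_shear: "det (jacobian_matrix (shear t)) = 1"
  unfolding det_jacobian
  by (simp_all add: neg_map_def shear_def varX_def varY_def deriv_X_pCons deriv_Y_pCons
      pderiv_pCons one_pCons)

lemma neg_map_involution: "neg_map \<circ>\<^sub>P neg_map = polymap_id"
  by (auto simp: polymap_comp_def neg_map_def polymap_id_def prod_eq_iff intro!: poly2_eqI)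

lemma shear_shear: "shear s \<circ>\<^sub>P shear t = shear (s + t)"
  by (auto simp: polymap_comp_def shear_def prod_eq_iff algebra_simps intro!: poly2_eqI)

lemma shear_0: "shear 0 = polymap_id"
  by (simp add: shear_def polymap_id_def)

lemma invertible_neg_map: "invertible_polymap neg_map"
  unfolding invertible_polymap_def using neg_map_involution by blast

lemma invertible_shear: "invertible_polymap (shear t)"
  unfolding invertible_polymap_def
  by (intro exI[of _ "shear (- t)"]) (simp add: shear_shear shear_0)

lemma keller_nonzero:
  assumes "det (jacobian_matrix F) = 1"
  shows "fst F \<noteq> 0" "snd F \<noteq> 0"
  using assms by (auto simp: det_jacobian)

lemma et_maps_iff:
  "F \<in> et_maps \<longleftrightarrow> det (jacobian_matrix F) = 1 \<and> (\<exists>n. tdeg_le n (fst F) \<and> ytop n (fst F) \<noteq> 0)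
     \<and> (\<exists>n. tdeg_le n (snd F) \<and> ytop n (snd F) \<noteq> 0)"
  unfolding et_maps_def mem_Collect_eq
  using keller_nonzero total_degree_eq_degree_iff by metis

lemma ytop_neg_map: "tdeg_le n p \<Longrightarrow> tdeg_le n (pullback neg_map p)"
  "tdeg_le n p \<Longrightarrow> ytop n (pullback neg_map p) = (- 1) ^ n * ytop n p"
proof -
  assume p: "tdeg_le n p"
  have lin: "tdeg_le 1 (fst neg_map)" "tdeg_le 1 (snd neg_map)"
    by (simp_all add: neg_map_def tdeg_le_uminus tdeg_le_varX tdeg_le_varY del: One_nat_def)
  have y: "ytop 1 (fst neg_map) = 0" "ytop 1 (snd neg_map) = - 1"
    by (simp_all add: neg_map_def ytop_def varX_def varY_def)
  show "tdeg_le n (pullback neg_map p)" using p lin by (rule tdeg_le_pullback_affine)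
  have "ytop n (pullback neg_map p) = (\<Sum>i\<in>{0}. coeff (coeff p (n - i)) i * 0 ^ i * (- 1) ^ (n - i))"
    unfolding ytop_pullback_affine[OF p lin] y by (rule sum.mono_neutral_right) auto
  then show "ytop n (pullback neg_map p) = (- 1) ^ n * ytop n p" by (simp add: ytop_def)
qed

lemma et_maps_comp_neg_map:
  assumes "F \<in> et_maps"
  shows "F \<circ>\<^sub>P neg_map \<in> et_maps"
proof -
  have "\<exists>n. tdeg_le n (pullback neg_map p) \<and> ytop n (pullback neg_map p) \<noteq> 0"
    if "\<exists>n. tdeg_le n p \<and> ytop n p \<noteq> 0" for p
    using that ytop_neg_map by fastforce
  moreover have "det (jacobian_matrix (F \<circ>\<^sub>P neg_map)) = 1"
    using assms by (simp add: det_jacobian_comp keller_neg_map et_maps_iff)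
  ultimately show ?thesis
    using assms unfolding et_maps_iff by (simp add: polymap_comp_pullback)
qed

lemma neg_map_comp: "neg_map \<circ>\<^sub>P F = (- fst F, - snd F)"
  by (auto simp: polymap_comp_def neg_map_def prod_eq_iff intro!: poly2_eqI)

lemma neg_map_comp_et_maps:
  assumes "F \<in> et_maps"
  shows "neg_map \<circ>\<^sub>P F \<in> et_maps"
proof -
  have "ytop n (- p) = - ytop n p" for n p by (simp add: ytop_def)
  moreover have "det (jacobian_matrix (neg_map \<circ>\<^sub>P F)) = 1"
    using assms by (simp add: det_jacobian_comp keller_neg_map et_maps_iff)
  ultimately show ?thesis
    using assms tdeg_le_uminus unfolding et_maps_iff neg_map_comp by fastforce
qed

text \<open>
  A mapping invariant under \<open>(x, y) \<mapsto> (- x, - y)\<close> has vanishing derivative at the origin.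
\<close>

lemma comp_neg_map_neq:
  assumes "det (jacobian_matrix F) = 1"
  shows "F \<circ>\<^sub>P neg_map \<noteq> F"
proof
  assume "F \<circ>\<^sub>P neg_map = F"
  then have inv: "pullback neg_map (fst F) = fst F" "pullback neg_map (snd F) = snd F"
    by (auto simp: polymap_comp_pullback prod_eq_iff)
  have *: "eval2 (deriv_X p) 0 0 = 0 \<and> eval2 (deriv_Y p) 0 0 = 0"
    if "pullback neg_map p = p" for p
  proof -
    have d: "deriv_X (- varX) = -1" "deriv_X (- varY) = 0" "deriv_Y (- varX) = 0" "deriv_Y (- varY) = -1"
      by (simp_all add: varX_def varY_def deriv_X_pCons deriv_Y_pCons pderiv_pCons one_pCons)
    have "deriv_X p = - pullback neg_map (deriv_X p)" "deriv_Y p = - pullback neg_map (deriv_Y p)"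
      using DX.chain_rule[of neg_map p] DY.chain_rule[of neg_map p] that
      by (simp_all add: neg_map_def d)
    then have "eval2 (deriv_X p) 0 0 = eval2 (- pullback neg_map (deriv_X p)) 0 0"
      "eval2 (deriv_Y p) 0 0 = eval2 (- pullback neg_map (deriv_Y p)) 0 0" by simp_all
    then show ?thesis by (simp add: neg_map_def)
  qed
  have "eval2 (det (jacobian_matrix F)) 0 0 = 0"
    using *[OF inv(1)] *[OF inv(2)] by (simp add: det_jacobian)
  with assms show False by simp
qed

text \<open>
  The coefficient of \<open>Y^n\<close> in \<open>p(X + t Y, Y)\<close>, with \<open>n\<close> the total degree of \<open>p\<close>, is the leading form
  of \<open>p\<close> evaluated at \<open>(t, 1)\<close>.  It is a nonzero polynomial in \<open>t\<close>.
\<close>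

lemma finite_bad_shears:
  assumes "p \<noteq> 0"
  shows "finite {t. \<not> (\<exists>n. tdeg_le n (pullback (shear t) p) \<and> ytop n (pullback (shear t) p) \<noteq> 0)}"
proof -
  define n where "n = total_degree p"
  have p: "tdeg_le n p" unfolding n_def by (rule tdeg_le_total_degree)
  define T where "T = (\<Sum>i\<le>n. monom (coeff (coeff p (n - i)) i) i)"
  have lin: "tdeg_le 1 (fst (shear t))" "tdeg_le 1 (snd (shear t))" for t
  proof -
    have "tdeg_le (0 + 1) ([:[:t:]:] * varY)" by (intro tdeg_le_mult tdeg_le_const tdeg_le_varY)
    then show "tdeg_le 1 (fst (shear t))" unfolding shear_def fst_conv
      by (intro tdeg_le_add tdeg_le_varX) simp
  qed (simp add: shear_def tdeg_le_varY del: One_nat_def)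
  have y: "ytop 1 (fst (shear t)) = t" "ytop 1 (snd (shear t)) = 1" for t
    by (simp_all add: shear_def ytop_def varX_def varY_def)
  have top: "ytop n (pullback (shear t) p) = poly T t" for t
    unfolding ytop_pullback_affine[OF p lin] y T_def by (simp add: poly_sum poly_monom)
  obtain i j where ij: "coeff (coeff p j) i \<noteq> 0" "i + j = n"
    using total_degree_attained[OF assms] unfolding n_def by blast
  then have "coeff T i \<noteq> 0" "j = n - i" 
    by (auto simp: T_def coeff_sum sum.delta)
  then have "T \<noteq> 0" by auto
  then have "finite {t. poly T t = 0}" by (rule poly_roots_finite)
  moreover have "{t. \<not> (\<exists>n. tdeg_le n (pullback (shear t) p) \<and> ytop n (pullback (shear t) p) \<noteq> 0)}
      \<subseteq> {t. poly T t = 0}"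
    using tdeg_le_pullback_affine[OF p lin] top by (metis (mono_tags, lifting) mem_Collect_eq subsetI)
  ultimately show ?thesis by (rule finite_subset[rotated])
qed

lemma keller_comp_shear_et:
  assumes "det (jacobian_matrix F) = 1"
  shows "\<exists>t. F \<circ>\<^sub>P shear t \<in> et_maps"
proof -
  let ?bad = "\<lambda>p. {t. \<not> (\<exists>n. tdeg_le n (pullback (shear t) p) \<and> ytop n (pullback (shear t) p) \<noteq> 0)}"
  have "finite (?bad (fst F) \<union> ?bad (snd F))"
    using finite_bad_shears keller_nonzero[OF assms] by blast
  then obtain t where "t \<notin> ?bad (fst F) \<union> ?bad (snd F)"
    using ex_new_if_finite[OF infinite_UNIV_char_0] by blast
  then have "F \<circ>\<^sub>P shear t \<in> et_maps"
    unfolding et_maps_iff using assms det_jacobian_comp[of F "shear t"]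
    by (simp add: keller_shear polymap_comp_pullback)
  then show ?thesis ..
qed

section \<open>Birational Keller maps are automorphisms\<close>

text \<open>
  Over \<open>\<complex>\<close> the polynomial \<open>c\<close> splits into linear factors, so the prime \<open>g\<close> divides one of the
  factors \<open>f - \<alpha>\<close> of \<open>c(f)\<close>.  In geometric terms: if \<open>f\<close> takes finitely many values on
  the curve \<open>g = 0\<close>, then \<open>f\<close> is constant there.
\<close>

lemma prime_elem_dvd_univariate:
  assumes g: "prime_elem g" and "c \<noteq> 0" "g dvd pullback (f, 0) [:c:]"
  shows "\<exists>\<alpha>. g dvd f - [:[:\<alpha>:]:]"
  using assms(2,3)
proof (induction "degree c" arbitrary: c)
  case 0
  then obtain a where a: "c = [:a:]" by (metis degree_eq_zeroE)
  then have "g dvd [:[:a:]:]" using "0.prems" by simp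
  moreover have "is_unit [:[:a:]:]"
    using a "0.prems" by (simp add: is_unit_const_poly_iff dvd_field_iff)
  ultimately have "is_unit g" using dvd_unit_imp_unit by blast
  with g show ?case by (simp add: prime_elem_def)
next
  case (Suc n)
  then obtain \<alpha> where "poly c \<alpha> = 0"
    using fundamental_theorem_of_algebra_alt[of c] by fastforce
  then obtain d where d: "c = [:-\<alpha>, 1:] * d" by (metis poly_eq_0_iff_dvd dvdE)
  have "pullback (f, 0) [:c:] = (f - [:[:\<alpha>:]:]) * pullback (f, 0) [:d:]"
    by (rule poly2_eqI) (simp add: d algebra_simps)
  then consider "g dvd f - [:[:\<alpha>:]:]" | "g dvd pullback (f, 0) [:d:]"
    using Suc.prems g by (metis prime_elem_dvd_multD)
  then show ?case
  proof cases
    case 2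
    have "d \<noteq> 0" using Suc.prems d by auto
    moreover from this have "n = degree d" using Suc.hyps(2) unfolding d
      by (subst (asm) degree_mult_eq) auto
    ultimately show ?thesis using Suc.hyps(1) 2 by blast
  qed blast
qed

text \<open>
  Division of \<open>p\<close> by \<open>X - \<alpha>\<close>; the remainder is the polynomial \<open>p(\<alpha>, Y)\<close>.
\<close>

lemma remainder_at_X:
  "\<exists>s d. \<forall>x y. eval2 p x y = (x - \<alpha>) * eval2 s x y + poly d y"
proof (induction p)
  case 0
  show ?case by (intro exI[of _ 0]) simp
next
  case (pCons c p)
  then obtain s d where sd: "\<And>x y. eval2 p x y = (x - \<alpha>) * eval2 s x y + poly d y" by blast
  have c: "poly c x = (x - \<alpha>) * poly (synthetic_div c \<alpha>) x + poly c \<alpha>" for x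
    by (subst (1) synthetic_div_correct'[of \<alpha> c, symmetric]) (simp add: algebra_simps)
  have ev: "eval2 (pCons c p) x y = poly c x + y * eval2 p x y" for c p x y
    by (simp add: eval2_def)
  have "eval2 (pCons c p) x y
      = (x - \<alpha>) * eval2 (pCons (synthetic_div c \<alpha>) s) x y + poly (pCons (poly c \<alpha>) d) y" for x y
    unfolding ev sd by (subst c) (simp add: algebra_simps)
  then show ?case by blast
qed

lemma prime_factor_of_positive_degree:
  fixes f :: cpoly2
  shows "degree f > 0 \<Longrightarrow> \<exists>g. prime_elem g \<and> g dvd f \<and> degree g > 0"
proof (induction f rule: prime_divisors_induct)
  case (unit x)
  then show ?case by (auto simp: is_unit_poly_iff)
next
  case (factor p x)
  then have "x \<noteq> 0" "p \<noteq> 0" by auto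
  then have "degree p > 0 \<or> degree x > 0" using factor.prems by (simp add: degree_mult_eq)
  then show ?case using factor by (meson dvd_mult dvd_triv_left prime_imp_prime_elem)
qed simp

text \<open>
  The irreducible curve \<open>\<pi> = 0\<close> meets \<open>p = 0\<close> in finitely many points, so a nonzero polynomial
  in \<open>X\<close> alone lies in the ideal generated by \<open>\<pi>\<close> and \<open>p\<close>.  Pseudo-division shows that an
  element of least \<open>Y\<close>-degree divides every element of the ideal up to a factor from \<open>\<complex>[X]\<close>; if its
  \<open>Y\<close>-degree were positive, it would contain a common prime factor.
\<close>

lemma eliminate_Y:
  fixes \<pi> p :: cpoly2
  assumes \<pi>: "prime_elem \<pi>" and ndvd: "\<not> \<pi> dvd p"
  shows "\<exists>a b c. c \<noteq> 0 \<and> a * \<pi> + b * p = [:c:]"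
proof -
  define J where "J = {a * \<pi> + b * p | a b. True}"
  have J_memI: "a * \<pi> + b * p \<in> J" for a b by (auto simp: J_def)
  have \<pi>J: "\<pi> \<in> J" and pJ: "p \<in> J" using J_memI[of 1 0] J_memI[of 0 1] by simp_all
  have J_comb: "u * h - f * q \<in> J" if hf: "h \<in> J" "f \<in> J" for u h f q
  proof -
    from hf obtain a b a' b' where "h = a * \<pi> + b * p" "f = a' * \<pi> + b' * p"
      unfolding J_def by blast
    then have "u * h - f * q = (u * a - a' * q) * \<pi> + (u * b - b' * q) * p" by algebra
    then show ?thesis using J_memI by simp
  qed
  have "\<pi> \<in> J \<and> \<pi> \<noteq> 0" using \<pi>J \<pi> by auto
  then obtain f where f: "f \<in> J" "f \<noteq> 0"
    and min: "\<And>h. h \<in> J \<Longrightarrow> h \<noteq> 0 \<Longrightarrow> degree f \<le> degree h"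
    using ex_has_least_nat[of "\<lambda>f. f \<in> J \<and> f \<noteq> 0" \<pi> degree] by blast
  show ?thesis
  proof (cases "degree f = 0")
    case True
    then obtain c where "f = [:c:]" by (metis degree_eq_zeroE)
    with f show ?thesis unfolding J_def by (auto intro: sym)
  next
    case False
    then obtain g where g: "prime_elem g" "g dvd f" "degree g > 0"
      using prime_factor_of_positive_degree by blast
    have dvd_J: "g dvd h" if h: "h \<in> J" for h
    proof -
      obtain c q where cq: "c \<noteq> 0" "smult c h = f * q + pseudo_mod h f"
        using pseudo_mod(1)[OF f(2)] by blast
      then have "pseudo_mod h f = [:c:] * h - f * q" by simp
      then have "pseudo_mod h f \<in> J" using J_comb[OF h f(1), of "[:c:]" q] by simp
      then have "pseudo_mod h f = 0" using pseudo_mod(2)[OF f(2), of h] min by fastforce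
      then have "g dvd [:c:] * h" using cq(2) g(2) by (simp add: dvd_mult2)
      moreover have "\<not> g dvd [:c:]" using dvd_imp_degree_le[of g "[:c:]"] cq(1) g(3) by auto
      ultimately show ?thesis using g(1) by (metis prime_elem_dvd_multD)
    qed
    have "\<pi> dvd g" using irreducibleD'[OF prime_elem_imp_irreducible[OF \<pi>] dvd_J[OF \<pi>J]] g(1)
      by (auto simp: prime_elem_def)
    with dvd_J[OF pJ] ndvd show ?thesis using dvd_trans by blast
  qed
qed

text \<open>
  If both components were constant along the curve \<open>g = 0\<close>, both gradients would be multiples of the
  gradient of \<open>g\<close> modulo \<open>g\<close>, and the Jacobian determinant would vanish modulo \<open>g\<close>.
\<close>

lemma keller_not_contracting:
  assumes F: "det (jacobian_matrix F) = 1" and g: "prime_elem g"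
    and "g dvd fst F - [:[:\<alpha>:]:]" "g dvd snd F - [:[:\<beta>:]:]"
  shows False
proof -
  obtain h k where "fst F - [:[:\<alpha>:]:] = g * h" "snd F - [:[:\<beta>:]:] = g * k"
    using assms(3,4) by (auto elim!: dvdE)
  then have hk: "fst F = [:[:\<alpha>:]:] + g * h" "snd F = [:[:\<beta>:]:] + g * k"
    by (simp_all add: algebra_simps)
  have "1 = (g * deriv_X h + deriv_X g * h) * (g * deriv_Y k + deriv_Y g * k)
      - (g * deriv_Y h + deriv_Y g * h) * (g * deriv_X k + deriv_X g * k)"
    using F unfolding det_jacobian hk
    by (simp only: DX.add DY.add DX.mult DY.mult DX.const DY.const add_0_left)
  also have "\<dots> = g * (g * deriv_X h * deriv_Y k + deriv_X h * deriv_Y g * k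
      + deriv_X g * h * deriv_Y k
      - g * deriv_Y h * deriv_X k - deriv_Y h * deriv_X g * k - deriv_Y g * h * deriv_X k)"
    by algebra
  finally have "g dvd 1" by (rule dvdI)
  with g show False by (simp add: prime_elem_def)
qed

text \<open>
  Pulling back by a Keller map preserves coprimality: a common factor \<open>g\<close> of \<open>\<pi>(F)\<close> and \<open>p(F)\<close>
  would be a curve that \<open>F\<close> maps into the finite set of common zeros of \<open>\<pi>\<close> and \<open>p\<close>, hence to
  a point, which \<open>keller_not_contracting\<close> excludes.
\<close>

lemma keller_pullback_coprime:
  assumes F: "det (jacobian_matrix F) = 1" and \<pi>: "prime_elem \<pi>" "\<not> \<pi> dvd p"
    and g: "prime_elem g" "g dvd pullback F \<pi>" "g dvd pullback F p"
  shows False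
proof -
  obtain a b c where c: "c \<noteq> 0" "a * \<pi> + b * p = [:c:]"
    using eliminate_Y[OF \<pi>] by blast
  have "pullback (fst F, 0) [:c:] = pullback F [:c:]" by (rule poly2_eqI) simp
  also have "\<dots> = pullback F a * pullback F \<pi> + pullback F b * pullback F p"
    unfolding c(2)[symmetric] by (simp only: pullback_add pullback_mult)
  finally have "g dvd pullback (fst F, 0) [:c:]" using g by simp
  then obtain \<alpha> where \<alpha>: "g dvd fst F - [:[:\<alpha>:]:]"
    using prime_elem_dvd_univariate[OF g(1) c(1)] by blast
  \<comment> \<open>Along \<open>g = 0\<close> the first component is \<open>\<alpha>\<close>, so a relation \<open>q(F) = 0\<close> there reduces to the
    relation \<open>q(\<alpha>, F\<^sub>2) = 0\<close> in the second component.\<close>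
  have snd: "\<exists>\<beta>. g dvd snd F - [:[:\<beta>:]:]"
    if q: "g dvd pullback F q" and sd: "\<And>x y. eval2 q x y = (x - \<alpha>) * eval2 s x y + poly d y"
      and "d \<noteq> 0" for q s d
  proof -
    have "pullback F q = (fst F - [:[:\<alpha>:]:]) * pullback F s + pullback (snd F, 0) [:d:]"
      by (rule poly2_eqI) (simp add: sd)
    then have "pullback (snd F, 0) [:d:] = pullback F q - (fst F - [:[:\<alpha>:]:]) * pullback F s"
      by (simp add: algebra_simps)
    then have "g dvd pullback (snd F, 0) [:d:]" using q \<alpha> by (simp add: dvd_diff)
    then show ?thesis by (rule prime_elem_dvd_univariate[OF g(1) \<open>d \<noteq> 0\<close>])
  qed
  let ?l = "[:[:-\<alpha>, 1:]:] :: cpoly2"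
  have l_dvd: "?l dvd q" if "\<And>x y. eval2 q x y = (x - \<alpha>) * eval2 s x y" for q s
  proof
    show "q = ?l * s" by (rule poly2_eqI) (simp add: that algebra_simps)
  qed
  obtain s d where sd: "\<And>x y. eval2 \<pi> x y = (x - \<alpha>) * eval2 s x y + poly d y"
    using remainder_at_X[of \<pi> \<alpha>] by blast
  obtain s' d' where sd': "\<And>x y. eval2 p x y = (x - \<alpha>) * eval2 s' x y + poly d' y"
    using remainder_at_X[of p \<alpha>] by blast
  \<comment> \<open>One of the two relations is nontrivial, since \<open>X - \<alpha>\<close> is not a common factor of \<open>\<pi>\<close> and \<open>p\<close>.\<close>
  have "d \<noteq> 0 \<or> d' \<noteq> 0"
  proof (rule ccontr)
    assume "\<not> ?thesis"
    then have "?l dvd \<pi>" "?l dvd p" using l_dvd[of \<pi> s] l_dvd[of p s'] sd sd' by simp_all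
    moreover have "\<not> is_unit ?l" by (simp add: is_unit_const_poly_iff is_unit_poly_iff)
    ultimately have "\<pi> dvd p"
      using irreducibleD'[OF prime_elem_imp_irreducible[OF \<pi>(1)]] dvd_trans by blast
    with \<pi>(2) show False by blast
  qed
  then obtain \<beta> where "g dvd snd F - [:[:\<beta>:]:]"
    using snd[OF g(2) sd] snd[OF g(3) sd'] by blast
  then show False using keller_not_contracting[OF F g(1) \<alpha>] by blast
qed

text \<open>
  An element of \<open>\<complex>[X, Y]\<close> that is a fraction of elements of \<open>\<complex>[F\<^sub>1, F\<^sub>2]\<close> belongs to
  \<open>\<complex>[F\<^sub>1, F\<^sub>2]\<close>: by \<open>keller_pullback_coprime\<close> every prime factor of the denominator \<open>q\<close> also
  divides the numerator \<open>p\<close> and can be cancelled.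
\<close>

lemma keller_clear_denominator:
  assumes F: "det (jacobian_matrix F) = 1" and "q \<noteq> 0" "pullback F q * a = pullback F p"
  shows "\<exists>r. a = pullback F r"
  using assms(2,3)
proof (induction q arbitrary: p rule: prime_divisors_induct)
  case (unit q)
  then obtain u where "1 = q * u" by (auto elim: dvdE)
  have "pullback F (u * p) = pullback F (q * u) * a"
    by (simp only: pullback_mult unit.prems(2) [symmetric] ac_simps)
  then show ?case using \<open>1 = q * u\<close> by (metis mult_1 pullback_1)
next
  case (factor \<pi> q)
  have \<pi>: "prime_elem \<pi>" "\<pi> \<noteq> 0" using factor.hyps by auto
  have \<pi>0: "pullback F \<pi> \<noteq> 0" using \<pi>(2) keller_pullback_eq_0[OF F] by blast
  show ?case
  proof (cases "\<pi> dvd p")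
    case True
    then obtain p' where "p = \<pi> * p'" by (auto elim: dvdE)
    then have "pullback F \<pi> * (pullback F q * a) = pullback F \<pi> * pullback F p'"
      using factor.prems(2) by (simp add: pullback_mult mult.assoc)
    then have "pullback F q * a = pullback F p'" using \<pi>0 by simp
    then show ?thesis using factor by auto
  next
    case False
    have "\<not> is_unit (pullback F \<pi>)"
    proof
      assume "is_unit (pullback F \<pi>)"
      then obtain c where c: "pullback F \<pi> = [:[:c:]:]" by (auto simp: is_unit_poly_iff)
      then have "pullback F \<pi> = pullback F [:[:c:]:]" by simp
      then have "\<pi> = [:[:c:]:]" using keller_inj[OF F] by blast
      then have "is_unit \<pi>" using \<pi>(2) by (simp add: is_unit_const_poly_iff dvd_field_iff)
      with \<pi>(1) show False by (simp add: prime_elem_def)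
    qed
    then obtain g where g: "prime g" "g dvd pullback F \<pi>"
      using prime_divisor_exists[OF \<pi>0] by blast
    have "pullback F p = pullback F \<pi> * (pullback F q * a)"
      using factor.prems(2) by (simp add: pullback_mult mult.assoc)
    then have "g dvd pullback F p" using g(2) by simp
    then show ?thesis
      using keller_pullback_coprime[OF F \<pi>(1) False] g prime_imp_prime_elem by blast
  qed
qed simp

text \<open>
  The assumption says that \<open>\<complex>(F\<^sub>1, F\<^sub>2)\<close> contains every polynomial, that is, that \<open>F\<close> is birational.  A left
  inverse is read off from \<open>X\<close> and \<open>Y\<close>; it is also a right inverse because the pullback by \<open>F\<close> is
  injective.
\<close>

lemma birational_keller_invertible:
  assumes F: "det (jacobian_matrix F) = 1"
    and birational: "\<And>a. \<exists>q p. q \<noteq> 0 \<and> pullback F q * a = pullback F p"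
  shows "invertible_polymap F"
proof -
  obtain r s where rs: "varX = pullback F r" "varY = pullback F s"
    using keller_clear_denominator[OF F] birational by meson
  then have left: "(r, s) \<circ>\<^sub>P F = polymap_id"
    by (simp add: polymap_comp_pullback polymap_id_def)
  then have "F \<circ>\<^sub>P ((r, s) \<circ>\<^sub>P F) = F" by simp
  then have "(F \<circ>\<^sub>P (r, s)) \<circ>\<^sub>P F = F" by (simp add: polymap_comp_assoc)
  then have "(F \<circ>\<^sub>P (r, s)) \<circ>\<^sub>P F = polymap_id \<circ>\<^sub>P F" by simp
  then have "F \<circ>\<^sub>P (r, s) = polymap_id"
    using keller_inj[OF F] by (simp add: polymap_comp_pullback[of _ F] prod_eq_iff)
  with left show ?thesis unfolding invertible_polymap_def by blast
qed

section \<open>The degree of the field extension given by a Keller map\<close>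

lemma (in vector_space) card_le_if_family_independent:
  assumes "finite T" "finite B" "\<And>t. t \<in> T \<Longrightarrow> f t \<in> span B"
    and ind: "\<And>u. (\<Sum>t\<in>T. scale (u t) (f t)) = 0 \<Longrightarrow> \<forall>t\<in>T. u t = 0"
  shows "card T \<le> card B"
proof -
  have inj: "inj_on f T"
  proof (rule inj_onI, rule ccontr)
    fix s t assume st: "s \<in> T" "t \<in> T" "f s = f t" "s \<noteq> t"
    define u :: "'c \<Rightarrow> 'a" where "u = (\<lambda>r. if r = s then 1 else if r = t then - 1 else 0)"
    have "(\<Sum>r\<in>T. scale (u r) (f r)) = (\<Sum>r\<in>{s, t}. scale (u r) (f r))"
      by (rule sum.mono_neutral_right) (use st \<open>finite T\<close> in \<open>auto simp: u_def\<close>)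
    also have "\<dots> = 0" using st by (simp add: u_def)
    finally have "u s = 0" using ind st(1) by blast
    then show False by (simp add: u_def)
  qed
  have "independent (f ` T)"
  proof (rule independent_if_scalars_zero)
    fix g x assume "(\<Sum>x\<in>f ` T. scale (g x) x) = 0" "x \<in> f ` T"
    then show "g x = 0" using ind[of "g \<circ> f"] by (auto simp: sum.reindex[OF inj])
  qed (use \<open>finite T\<close> in simp)
  then have "card (f ` T) \<le> card B"
    using independent_span_bound[OF \<open>finite B\<close>] assms(3) by blast
  then show ?thesis by (simp add: card_image[OF inj])
qed

interpretation cpoly2: vector_space "\<lambda>a (p :: cpoly2). smult [:a:] p"
  by standard (simp_all add: smult_add_right mult.commute flip: smult_add_left one_pCons)

text \<open>
  Linear independence of \<open>v\<close> over \<open>\<complex>[F\<^sub>1, F\<^sub>2]\<close>, or equivalently, after clearing denominators, over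
  its fraction field.  The coefficients are named by their preimages under the pullback, so the
  condition has this meaning when the pullback is injective.
\<close>

definition pullback_indep :: "polymap \<Rightarrow> nat \<Rightarrow> (nat \<Rightarrow> cpoly2) \<Rightarrow> bool" where
  "pullback_indep F n v \<longleftrightarrow>
    (\<forall>c. (\<Sum>i<n. pullback F (c i) * v i) = 0 \<longrightarrow> (\<forall>i<n. c i = 0))"

lemma tdeg_le_in_span:
  assumes "tdeg_le n p"
  shows "p \<in> cpoly2.span ((\<lambda>(i, j). monom (monom 1 i) j) ` ({..n} \<times> {..n}))"
proof -
  let ?S = "cpoly2.span ((\<lambda>(i, j). monom (monom 1 i) j) ` ({..n} \<times> {..n}))"
  have "monom (monom a i) j \<in> ?S" if "i \<le> n" "j \<le> n" for a :: complex and i j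
  proof -
    have "smult [:a:] (monom (monom 1 i) j) \<in> ?S"
      by (rule cpoly2.span_scale, rule cpoly2.span_base) (use that in force)
    then show ?thesis by (simp add: smult_monom)
  qed
  then have "(\<Sum>j\<le>n. \<Sum>i\<le>n. monom (monom (coeff (coeff p j) i) i) j) \<in> ?S"
    by (intro cpoly2.span_sum) auto
  then show ?thesis by (simp only: tdeg_le_expansion[OF assms, symmetric])
qed

text \<open>
  A dimension count.  With \<open>N\<close> bounding the total degrees of the \<open>v i\<close>, an independent family
  yields \<open>n * (N + 1)\<^sup>2\<close> products \<open>F\<^sub>1^a * F\<^sub>2^b * v i\<close> with \<open>a, b \<le> N\<close> that are linearly
  independent over \<open>\<complex>\<close>, inside a space of dimension at most \<open>((2 d + 1) (N + 1))\<^sup>2\<close>.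
\<close>

lemma pullback_indep_bound:
  assumes d: "tdeg_le d (fst F)" "tdeg_le d (snd F)" and ind: "pullback_indep F n v"
  shows "n \<le> (2 * d + 1)\<^sup>2"
proof -
  define N where "N = (\<Sum>i<n. total_degree (v i))"
  define M where "M = N * d + N * d + N"
  define T where "T = {..<n} \<times> {..N} \<times> {..N}"
  define f where "f = (\<lambda>(i, a, b). (fst F ^ a * snd F ^ b) * v i)"
  define B where "B = (\<lambda>(i, j). monom (monom 1 i) j :: cpoly2) ` ({..M} \<times> {..M})"
  have v: "tdeg_le N (v i)" if "i < n" for i
  proof (rule tdeg_le_mono[OF tdeg_le_total_degree])
    show "total_degree (v i) \<le> N" unfolding N_def using that by (intro member_le_sum) auto
  qed
  have "card T \<le> card B"
  proof (rule cpoly2.card_le_if_family_independent)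
    fix t assume "t \<in> T"
    then obtain i a b where t: "t = (i, a, b)" "i < n" "a \<le> N" "b \<le> N"
      by (auto simp: T_def)
    have "tdeg_le (a * d + b * d + N) (f t)"
      unfolding f_def t by (auto intro!: tdeg_le_mult tdeg_le_power d v t)
    then have "tdeg_le M (f t)"
      by (rule tdeg_le_mono) (use t in \<open>auto simp: M_def intro!: add_mono mult_right_mono\<close>)
    then show "f t \<in> cpoly2.span B" unfolding B_def by (rule tdeg_le_in_span)
  next
    fix u assume u: "(\<Sum>t\<in>T. smult [:u t:] (f t)) = 0"
    define c where "c = (\<lambda>i. \<Sum>b\<le>N. \<Sum>a\<le>N. monom (monom (u (i, a, b)) a) b)"
    have "(\<Sum>i<n. pullback F (c i) * v i)
        = (\<Sum>i<n. \<Sum>b\<le>N. \<Sum>a\<le>N. smult [:u (i, a, b):] (f (i, a, b)))"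
      unfolding c_def by (simp add: pullback_sum pullback_monom sum_distrib_right f_def)
    also have "\<dots> = (\<Sum>i<n. \<Sum>a\<le>N. \<Sum>b\<le>N. smult [:u (i, a, b):] (f (i, a, b)))"
      by (subst (2) sum.swap) simp
    also have "\<dots> = (\<Sum>t\<in>T. smult [:u t:] (f t))"
      unfolding T_def by (simp add: sum.cartesian_product)
    finally have "\<forall>i<n. c i = 0" using ind u unfolding pullback_indep_def by simp
    then have "coeff (coeff (c i) b) a = 0" if "i < n" for i a b using that by simp
    then have "u (i, a, b) = 0" if "i < n" "a \<le> N" "b \<le> N" for i a b
      using that unfolding c_def coeff_sum_monom by metis
    then show "\<forall>t\<in>T. u t = 0" by (auto simp: T_def)
  qed (auto simp: T_def B_def)
  moreover have "card T = n * (N + 1)\<^sup>2" by (simp add: T_def power2_eq_square)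
  moreover have "card B \<le> (M + 1)\<^sup>2"
    using card_image_le[of "{..M} \<times> {..M}" "\<lambda>(i, j). monom (monom 1 i) j :: cpoly2"]
    by (simp add: B_def power2_eq_square)
  moreover have "(M + 1)\<^sup>2 \<le> ((2 * d + 1) * (N + 1))\<^sup>2"
    by (rule power_mono) (auto simp: M_def algebra_simps)
  ultimately have "n * (N + 1)\<^sup>2 \<le> (2 * d + 1)\<^sup>2 * (N + 1)\<^sup>2"
    unfolding power_mult_distrib by (metis le_trans)
  moreover have "0 < (N + 1)\<^sup>2" by simp
  ultimately show ?thesis by (rule mult_right_le_imp_le)
qed

text \<open>
  For a Keller map this is the degree \<open>[\<complex>(X, Y) : \<complex>(F\<^sub>1, F\<^sub>2)]\<close>: every independent family of
  fractions can be multiplied by a common denominator, so polynomials suffice.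
\<close>

definition extension_degree :: "polymap \<Rightarrow> nat" where
  "extension_degree F = Max {n. \<exists>v. pullback_indep F n v}"

lemma finite_pullback_indep: "finite {n. \<exists>v. pullback_indep F n v}"
proof -
  define d where "d = max (total_degree (fst F)) (total_degree (snd F))"
  have "tdeg_le d (fst F)" "tdeg_le d (snd F)"
    unfolding d_def by (rule tdeg_le_mono[OF tdeg_le_total_degree], rule max.cobounded1,
        rule tdeg_le_mono[OF tdeg_le_total_degree], rule max.cobounded2)
  then have "{n. \<exists>v. pullback_indep F n v} \<subseteq> {..(2 * d + 1)\<^sup>2}"
    using pullback_indep_bound by blast
  then show ?thesis by (rule finite_subset) simp
qed

text \<open>
  The fields \<open>\<complex>(G \<circ> H) \<subset> \<complex>(H) \<subseteq> \<complex>(X, Y)\<close> form a tower, and the assumption on \<open>a\<close> makes the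
  first inclusion proper, because \<open>a(H)\<close> is not a fraction over \<open>\<complex>[G \<circ> H]\<close>.  Concretely, an
  independent family over the larger field becomes a longer one over the smaller field by
  adjoining the product of \<open>a(H)\<close> with its first member.
\<close>

lemma extension_degree_less_comp:
  assumes G: "det (jacobian_matrix G) = 1" and H: "det (jacobian_matrix H) = 1"
    and a: "\<And>q p. pullback G q * a = pullback G p \<Longrightarrow> q = 0"
  shows "extension_degree H < extension_degree (G \<circ>\<^sub>P H)"
proof -
  define n where "n = extension_degree H"
  have one: "pullback_indep H 1 (\<lambda>_. 1)"
    using keller_pullback_eq_0[OF H] by (simp add: pullback_indep_def)
  have "n \<in> {n. \<exists>v. pullback_indep H n v}"
    unfolding n_def extension_degree_def using one finite_pullback_indep by (intro Max_in) auto
  then obtain v where v: "pullback_indep H n v" by blast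
  have n: "n > 0"
    unfolding n_def extension_degree_def using one finite_pullback_indep
    by (metis (mono_tags, lifting) Max_ge mem_Collect_eq less_le_trans zero_less_one)
  define w where "w = v(n := pullback H a * v 0)"
  have "pullback_indep (G \<circ>\<^sub>P H) (Suc n) w"
    unfolding pullback_indep_def
  proof (intro allI impI)
    fix c i assume sum0: "(\<Sum>i<Suc n. pullback (G \<circ>\<^sub>P H) (c i) * w i) = 0" and i: "i < Suc n"
    \<comment> \<open>The coefficients of the relation regrouped over \<open>\<complex>[H\<^sub>1, H\<^sub>2]\<close>, where the adjoined element
      contributes to the first one.\<close>
    define c' where "c' = (\<lambda>i. pullback G (c i) + (if i = 0 then pullback G (c n) * a else 0))"
    have "(\<Sum>i<n. pullback H (c' i) * v i)
        = (\<Sum>i<n. pullback H (pullback G (c i)) * v i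
             + (if i = 0 then pullback H (pullback G (c n) * a) * v 0 else 0))"
      by (intro sum.cong) (auto simp: c'_def pullback_add algebra_simps)
    also have "\<dots> = (\<Sum>i<Suc n. pullback (G \<circ>\<^sub>P H) (c i) * w i)"
      using n by (simp add: sum.distrib w_def pullback_comp pullback_mult mult.assoc)
    finally have c': "\<And>i. i < n \<Longrightarrow> c' i = 0"
      using v sum0 unfolding pullback_indep_def by metis
    have "pullback G (c n) * a = pullback G (- c 0)"
      using c'[OF n] by (simp add: c'_def pullback_uminus eq_neg_iff_add_eq_0 add.commute)
    then have cn: "c n = 0" by (rule a)
    then have "pullback G (c i) = 0" if "i < n" for i
      using c'[OF that] by (simp add: c'_def split: if_splits)
    then show "c i = 0" using cn i keller_pullback_eq_0[OF G] less_Suc_eq by blast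
  qed
  then have "Suc n \<le> extension_degree (G \<circ>\<^sub>P H)"
    unfolding extension_degree_def using finite_pullback_indep by (intro Max_ge) auto
  then show ?thesis by (simp add: n_def)
qed

section \<open>Prime mappings and the failure of disjointness\<close>

text \<open>
  A mapping of least extension degree outside the automorphisms is prime: in a factorization
  \<open>G \<circ>\<^sub>P H\<close> the mapping \<open>G\<close> is not birational, so \<open>H\<close> would have smaller extension degree.
\<close>

lemma non_automorphism_imp_prime_exists:
  assumes "et_maps - et_Aut \<noteq> {}"
  shows "et_prime \<noteq> {}"
proof -
  obtain F where F: "F \<in> et_maps - et_Aut"
    and min: "\<And>H. H \<in> et_maps - et_Aut \<Longrightarrow> extension_degree F \<le> extension_degree H"
    using assms ex_has_least_nat[of "\<lambda>F. F \<in> et_maps - et_Aut" _ extension_degree] by blast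
  have "\<not> et_composite F"
  proof
    assume "et_composite F"
    then obtain G H where GH: "G \<in> et_maps - et_Aut" "H \<in> et_maps - et_Aut" "F = G \<circ>\<^sub>P H"
      by (auto simp: et_composite_def)
    then have K: "det (jacobian_matrix G) = 1" "det (jacobian_matrix H) = 1"
      by (auto simp: et_maps_def)
    have "\<not> invertible_polymap G" using GH by (auto simp: et_Aut_def)
    then obtain a where "\<And>q p. pullback G q * a = pullback G p \<Longrightarrow> q = 0"
      using birational_keller_invertible[OF K(1)] by blast
    then have "extension_degree H < extension_degree F"
      using extension_degree_less_comp[OF K] GH(3) by blast
    with min[OF GH(2)] show False by simp
  qed
  with F have "F \<in> et_prime" by (simp add: et_prime_def)
  then show ?thesis by blast
qed

text \<open>
  The reflection can be moved into the right-hand factor of any factorization.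
\<close>

lemma et_prime_comp_neg_map:
  assumes "F \<in> et_prime"
  shows "F \<circ>\<^sub>P neg_map \<in> et_prime"
proof -
  have nonaut: "K \<circ>\<^sub>P neg_map \<in> et_maps - et_Aut" if "K \<in> et_maps - et_Aut" for K
    using that et_maps_comp_neg_map invertible_polymap_comp_right_iff[OF invertible_neg_map]
    by (auto simp: et_Aut_def)
  have "\<not> et_composite (F \<circ>\<^sub>P neg_map)"
  proof
    assume "et_composite (F \<circ>\<^sub>P neg_map)"
    then obtain G H where GH: "G \<in> et_maps - et_Aut" "H \<in> et_maps - et_Aut"
        "F \<circ>\<^sub>P neg_map = G \<circ>\<^sub>P H"
      by (auto simp: et_composite_def)
    have "F = F \<circ>\<^sub>P (neg_map \<circ>\<^sub>P neg_map)" by (simp add: neg_map_involution)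
    also have "\<dots> = G \<circ>\<^sub>P (H \<circ>\<^sub>P neg_map)"
      using GH(3) by (simp flip: polymap_comp_assoc)
    finally have "et_composite F"
      unfolding et_composite_def using GH nonaut by blast
    with assms show False by (simp add: et_prime_def)
  qed
  with assms nonaut show ?thesis by (simp add: et_prime_def)
qed

lemma invertible_polymap_fun:
  assumes "invertible_polymap F"
  shows "inj (polymap_fun F) \<and> surj (polymap_fun F) \<and>
      (\<exists>G. inv (polymap_fun F) = polymap_fun G)"
proof -
  obtain G where G: "F \<circ>\<^sub>P G = polymap_id" "G \<circ>\<^sub>P F = polymap_id"
    using assms unfolding invertible_polymap_def by blast
  then have *: "polymap_fun F \<circ> polymap_fun G = id" "polymap_fun G \<circ> polymap_fun F = id"
    by (metis polymap_fun_comp polymap_fun_id)+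
  then have "bij (polymap_fun F)" by (rule o_bij[rotated])
  moreover have "inv (polymap_fun F) = polymap_fun G" by (rule inv_unique_comp[OF *])
  ultimately show ?thesis by (blast dest: bij_is_inj bij_is_surj)
qed

theorem theorem11p17:
  assumes disjointness: "\<And>F G. F \<in> et_prime \<Longrightarrow> G \<in> et_prime \<Longrightarrow> F \<noteq> G \<Longrightarrow>
      left_comp F ` et_maps \<inter> left_comp G ` et_maps = {}"
  shows "\<forall>F :: polymap. det (jacobian_matrix F) = 1 \<longrightarrow>
      inj (polymap_fun F) \<and> surj (polymap_fun F) \<and>
      (\<exists>G :: polymap. inv (polymap_fun F) = polymap_fun G)"
proof (intro allI impI)
  fix F :: polymap assume F: "det (jacobian_matrix F) = 1"
  have "invertible_polymap F"
  proof (rule ccontr)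
    assume noninv: "\<not> invertible_polymap F"
    obtain t where "F \<circ>\<^sub>P shear t \<in> et_maps" using keller_comp_shear_et[OF F] by blast
    then have "F \<circ>\<^sub>P shear t \<in> et_maps - et_Aut"
      using noninv invertible_polymap_comp_right_iff[OF invertible_shear]
      by (auto simp: et_Aut_def)
    then obtain P where P: "P \<in> et_prime" using non_automorphism_imp_prime_exists by blast
    then have et: "P \<in> et_maps" by (simp add: et_prime_def)
    then have "P \<noteq> P \<circ>\<^sub>P neg_map" using comp_neg_map_neq[of P] by (auto simp: et_maps_def)
    then have "left_comp P ` et_maps \<inter> left_comp (P \<circ>\<^sub>P neg_map) ` et_maps = {}"
      using disjointness P et_prime_comp_neg_map by blast
    moreover have "left_comp (P \<circ>\<^sub>P neg_map) P = left_comp P (neg_map \<circ>\<^sub>P P)"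
      by (simp add: left_comp_def polymap_comp_assoc)
    ultimately show False using et neg_map_comp_et_maps[OF et] by blast
  qed
  then show "inj (polymap_fun F) \<and> surj (polymap_fun F) \<and>
      (\<exists>G. inv (polymap_fun F) = polymap_fun G)"
    by (rule invertible_polymap_fun)
qed

end
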